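(* For every non-negative integer $n$ and every integer $s$, \[ \sum_{k = 1}^{\lceil n/2 \rceil} \binom {n}{2k-1} 4^k F_{2k + s} = \begin{cases} F_{3n + 1 + s} - 5^{n/2}F_{s+1}, & \text{$n$ even;}\\ F_{3n + 1 + s} + 5^{(n-1)/2}L_{s+1}, & \text{$n$ odd,} \end{cases} \qquad \sum_{k = 1}^{\lceil n/2 \rceil} \binom {n}{2k-1} 4^k L_{2k + s} = \begin{cases} L_{3n + 1 + s} - 5^{n/2} L_{s+1}, & \text{$n$ even;}\\ L_{3n + 1 + s} + 5^{(n+1)/2}F_{s+1}, & \text{$n$ odd.} \end{cases} \]
   Context: The Fibonacci numbers $F_j$ and Lucas numbers $L_j$ are defined for all integers $j$ by $F_0=0$, $F_1=1$, $L_0=2$, $L_1=1$, $F_j=F_{j-1}+F_{j-2}$, $L_j=L_{j-1}+L_{j-2}$, with $F_{-j}=(-1)^{j-1}F_j$ and $L_{-j}=(-1)^jL_j$. An empty sum equals $0$. *)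

theory Defs
  imports Complex_Main "HOL-Number_Theory.Fib"
begin

fun lucas :: "nat \<Rightarrow> nat" where
  "lucas 0 = 2"
| "lucas (Suc 0) = 1"
| "lucas (Suc (Suc n)) = lucas (Suc n) + lucas n"

text \<open>Extension to all integer indices by
  \<open>F\<^bsub>-j\<^esub> = (-1)\<^bsup>j-1\<^esup> F\<^bsub>j\<^esub>\<close> and \<open>L\<^bsub>-j\<^esub> = (-1)\<^bsup>j\<^esup> L\<^bsub>j\<^esub>\<close>.\<close>

definition fib_int :: "int \<Rightarrow> int" where
  "fib_int j = (if 0 \<le> j then int (fib (nat j))
            else (-1) ^ (nat (- j) - 1) * int (fib (nat (- j))))"

definition lucas_int :: "int \<Rightarrow> int" where
  "lucas_int j = (if 0 \<le> j then int (lucas (nat j))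
            else (-1) ^ nat (- j) * int (lucas (nat (- j))))"

lemma fib_int_init: "fib_int 0 = 0" "fib_int 1 = 1"
  by (simp_all add: fib_int_def)

lemma lucas_int_init: "lucas_int 0 = 2" "lucas_int 1 = 1"
  by (simp_all add: lucas_int_def)

lemma int_index_cases:
  fixes j :: int
  obtains (nonneg) m where "j = int m + 2" | (one) "j = 1" | (zero) "j = 0"
    | (neg) m where "j = - int (Suc m)"
proof -
  consider "j \<ge> 2" | "j = 1" | "j = 0" | "j < 0" by linarith
  then show ?thesis
  proof cases
    case 1
    then have "j = int (nat (j - 2)) + 2" by simp
    then show ?thesis by (rule nonneg)
  next
    case 4
    then have "j = - int (Suc (nat (- j - 1)))" by simp
    then show ?thesis by (rule neg)
  qed (use one zero in auto)
qed

lemma nat_int_add2: "nat (int m + 2) = Suc (Suc m)" "nat (int m + 2 - 1) = Suc m"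
  "nat (int m + 2 - 2) = m"
  by simp_all

lemma nat_neg_index: "nat (- (- int (Suc m))) = Suc m"
  "nat (- (- int (Suc m) - 1)) = Suc (Suc m)"
  "nat (- (- int (Suc m) - 2)) = Suc (Suc (Suc m))"
  by simp_all

lemma fib_int_rec: "fib_int j = fib_int (j - 1) + fib_int (j - 2)"
proof (cases j rule: int_index_cases)
  case (nonneg m)
  then show ?thesis unfolding fib_int_def nonneg nat_int_add2 by simp
next
  case (neg m)
  then show ?thesis unfolding fib_int_def neg nat_neg_index by (simp add: algebra_simps)
qed (simp_all add: fib_int_def numeral_eq_Suc)

lemma lucas_int_rec: "lucas_int j = lucas_int (j - 1) + lucas_int (j - 2)"
proof (cases j rule: int_index_cases)
  case (nonneg m)
  then show ?thesis unfolding lucas_int_def nonneg nat_int_add2 by simp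
next
  case (neg m)
  then show ?thesis unfolding lucas_int_def neg nat_neg_index by (simp add: algebra_simps)
qed (simp_all add: lucas_int_def numeral_eq_Suc)

lemma fib_int_minus: "fib_int (- int j) = (-1) ^ (j + 1) * fib_int (int j)"
  by (cases j) (simp_all add: fib_int_def del: of_nat_Suc)

lemma lucas_int_minus: "lucas_int (- int j) = (-1) ^ j * lucas_int (int j)"
  by (cases j) (simp_all add: lucas_int_def del: of_nat_Suc)

end

theory Submission
  imports Defs
begin

text \<open>
  Let \<open>G\<close> satisfy the Fibonacci recurrence. Since \<open>1 + 2x = x\<^sup>3\<close> and \<open>(1 - 2x)\<^sup>2 = 5\<close> for each
  root \<open>x\<close> of \<open>x\<^sup>2 = x + 1\<close>, the binomial transform of \<open>G\<close> with weights \<open>2\<^sup>j\<close> shifts the index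
  by \<open>3n\<close>, while the one with weights \<open>(-2)\<^sup>j\<close> multiplies by powers of 5 and exchanges Fibonacci
  and Lucas numbers when \<open>n\<close> is odd. Subtracting the two leaves the terms of odd index.
\<close>

text \<open>With \<open>E\<close> the shift of \<open>t\<close> by 1, the hypothesis says that
  \<open>T n\<close> is \<open>(1 + c E)^n\<close> applied to \<open>T 0\<close>; the sum is its
  binomial expansion.\<close>

lemma binomial_transform_eqI:
  fixes T :: "nat \<Rightarrow> int \<Rightarrow> 'a::comm_ring_1"
  assumes step: "\<And>n t. T (Suc n) t = T n t + c * T n (t + 1)"
  shows "(\<Sum>j\<le>n. of_nat (n choose j) * c ^ j * T 0 (int j + t)) = T n t"
proof (induction n arbitrary: t)
  case 0
  then show ?case by simp
next
  case (Suc n)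
  let ?f = "\<lambda>j. of_nat (n choose j) * c ^ j * T 0 (int j + t)"
  let ?g = "\<lambda>j. of_nat (n choose j) * c ^ j * T 0 (int j + (t + 1))"
  \<comment> \<open>Pascal's rule; the part with the extra factor \<open>c\<close> is the same sum
    at \<open>t + 1\<close>, hence the induction over arbitrary \<open>t\<close>.\<close>
  have "(\<Sum>j\<le>Suc n. of_nat (Suc n choose j) * c ^ j * T 0 (int j + t))
      = T 0 t + (\<Sum>j\<le>n. ?f (Suc j) + c * ?g j)"
    by (subst sum.atMost_Suc_shift) (simp add: algebra_simps)
  also have "\<dots> = (T 0 t + (\<Sum>j\<le>n. ?f (Suc j))) + c * (\<Sum>j\<le>n. ?g j)"
    by (simp add: sum.distrib sum_distrib_left)
  also have "T 0 t + (\<Sum>j\<le>n. ?f (Suc j)) = (\<Sum>j\<le>Suc n. ?f j)"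
    by (subst sum.atMost_Suc_shift) simp
  also have "\<dots> = (\<Sum>j\<le>n. ?f j)" by (simp add: binomial_eq_0)
  finally show ?case by (simp only: Suc.IH step)
qed

text \<open>The weight vanishes for even \<open>j\<close>, and for \<open>j = 2 * k - 1\<close> it
  is \<open>2 * 2 ^ j = 4 ^ k\<close>.\<close>

lemma sum_odd_weights:
  fixes a :: "nat \<Rightarrow> int"
  shows "(\<Sum>j\<le>n. (2 ^ j - (-2) ^ j) * a j) = (\<Sum>k = 1..(n + 1) div 2. 4 ^ k * a (2 * k - 1))"
proof (induction n)
  case 0
  then show ?case by simp
next
  case (Suc n)
  show ?case
  proof (cases "even n")
    case True
    then obtain m where "n = 2 * m" by (elim evenE)
    with Suc show ?thesis by (simp add: power_mult)
  next
    case False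
    then obtain m where "n = 2 * m + 1" by (elim oddE)
    with Suc show ?thesis by simp
  qed
qed

lemma nat_ceiling_half: "nat \<lceil>real n / 2\<rceil> = (n + 1) div 2"
proof -
  have "\<lceil>real n / 2\<rceil> = int ((n + 1) div 2)"
    by (rule ceiling_unique) (cases "even n"; auto elim!: evenE oddE)+
  then show ?thesis by simp
qed

text \<open>Here \<open>T\<close> stands for a closed form of the transform of \<open>G\<close> with
  weights \<open>(-2) ^ j\<close>, to be supplied separately for Fibonacci and Lucas
  numbers.\<close>

lemma odd_binomial_sum:
  fixes T :: "nat \<Rightarrow> int \<Rightarrow> int"
  assumes rec: "\<And>j. G j = G (j - 1) + G (j - 2)"
    and init: "\<And>t. T 0 t = G t"
    and step: "\<And>n t. T (Suc n) t = T n t - 2 * T n (t + 1)"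
  shows "(\<Sum>k = 1..nat \<lceil>real n / 2\<rceil>. int (n choose (2 * k - 1)) * 4 ^ k * G (2 * int k + s))
    = G (3 * int n + 1 + s) - T n (s + 1)"
proof -
  \<comment> \<open>This is \<open>x^3 = 1 + 2x\<close> read as a recurrence.\<close>
  have shift: "G (3 * int (Suc m) + t) = G (3 * int m + t) + 2 * G (3 * int m + (t + 1))" for m t
    using rec[of "3 * int m + t + 3"] rec[of "3 * int m + t + 2"] by (simp add: algebra_simps)
  \<comment> \<open>The offset is \<open>s + 1\<close> because
    \<open>2k + s = (2k - 1) + (s + 1)\<close>.\<close>
  have plus: "(\<Sum>j\<le>n. int (n choose j) * 2 ^ j * G (int j + (s + 1))) = G (3 * int n + (s + 1))"
    using binomial_transform_eqI[of "\<lambda>m t. G (3 * int m + t)" 2 n "s + 1", OF shift] by simp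
  have minus: "(\<Sum>j\<le>n. int (n choose j) * (-2) ^ j * G (int j + (s + 1))) = T n (s + 1)"
    using binomial_transform_eqI[of T "-2" n "s + 1"] step by (simp add: init)
  let ?a = "\<lambda>j. int (n choose j) * G (int j + (s + 1))"
  have "(\<Sum>k = 1..nat \<lceil>real n / 2\<rceil>. int (n choose (2 * k - 1)) * 4 ^ k * G (2 * int k + s))
      = (\<Sum>k = 1..(n + 1) div 2. 4 ^ k * ?a (2 * k - 1))"
    by (intro sum.cong) (auto simp: nat_ceiling_half of_nat_diff algebra_simps)
  also have "\<dots> = (\<Sum>j\<le>n. (2 ^ j - (-2) ^ j) * ?a j)"
    by (rule sum_odd_weights[symmetric])
  also have "\<dots> = G (3 * int n + (s + 1)) - T n (s + 1)"
    unfolding plus[symmetric] minus[symmetric] sum_subtractf[symmetric]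
    by (intro sum.cong) (simp_all add: algebra_simps)
  finally show ?thesis by (simp add: algebra_simps)
qed

text \<open>This and the next lemma say that \<open>1 - 2E\<close> sends \<open>F\<close> to
  \<open>-L\<close> and \<open>L\<close> to \<open>-5F\<close>. The recurrences have order two, so
  two consecutive instances are carried through the induction in both directions.\<close>

lemma lucas_int_eq_fib_int: "lucas_int t = 2 * fib_int (t + 1) - fib_int t"
proof -
  let ?P = "\<lambda>t. lucas_int t = 2 * fib_int (t + 1) - fib_int t"
  have "?P t \<and> ?P (t + 1)"
  proof (induction t rule: int_induct[where k = 0])
    case base
    show ?case using fib_int_rec[of 2] by (simp add: fib_int_init lucas_int_init)
  next
    case (step1 i)
    then show ?case
      using fib_int_rec[of "i + 2"] fib_int_rec[of "i + 3"] lucas_int_rec[of "i + 2"]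
      by (simp add: algebra_simps)
  next
    case (step2 i)
    then show ?case
      using fib_int_rec[of "i + 1"] fib_int_rec[of "i + 2"] lucas_int_rec[of "i + 1"]
      by (simp add: algebra_simps)
  qed
  then show ?thesis ..
qed

lemma fib_int_eq_lucas_int: "5 * fib_int t = 2 * lucas_int (t + 1) - lucas_int t"
  using fib_int_rec[of "t + 2"] by (simp add: lucas_int_eq_fib_int algebra_simps)

theorem theorem20:
  fixes n :: nat and s :: int
  shows "(\<Sum>k = 1..nat \<lceil>real n / 2\<rceil>. int (n choose (2 * k - 1)) * 4 ^ k * fib_int (2 * int k + s))
           = (if even n then fib_int (3 * int n + 1 + s) - 5 ^ (n div 2) * fib_int (s + 1)
              else fib_int (3 * int n + 1 + s) + 5 ^ ((n - 1) div 2) * lucas_int (s + 1))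
       \<and> (\<Sum>k = 1..nat \<lceil>real n / 2\<rceil>. int (n choose (2 * k - 1)) * 4 ^ k * lucas_int (2 * int k + s))
           = (if even n then lucas_int (3 * int n + 1 + s) - 5 ^ (n div 2) * lucas_int (s + 1)
              else lucas_int (3 * int n + 1 + s) + 5 ^ ((n + 1) div 2) * fib_int (s + 1))"
proof -
  \<comment> \<open>These are \<open>(1 - 2E)^n\<close> applied to \<open>F\<close> and
    \<open>L\<close>: two steps multiply by 5, and a single step swaps the sequences with a minus
    sign.\<close>
  let ?TF = "\<lambda>n t. if even n then 5 ^ (n div 2) * fib_int t
                   else - (5 ^ ((n - 1) div 2) * lucas_int t)"
  let ?TL = "\<lambda>n t. if even n then 5 ^ (n div 2) * lucas_int t
                   else - (5 ^ ((n + 1) div 2) * fib_int t)"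
  \<comment> \<open>As a general rewrite rule this would loop, so it is used below only at the fixed
    \<open>t\<close>.\<close>
  have lucas: "lucas_int t = 2 * lucas_int (t + 1) - 5 * fib_int t" for t
    using fib_int_eq_lucas_int[of t] by simp
  have stepF: "?TF (Suc m) t = ?TF m t - 2 * ?TF m (t + 1)" for m t
  proof (cases "even m")
    case True
    then show ?thesis by (simp add: lucas_int_eq_fib_int algebra_simps)
  next
    case False
    then obtain k where m: "m = 2 * k + 1" by (elim oddE)
    show ?thesis by (simp add: m lucas[of t] algebra_simps)
  qed
  have stepL: "?TL (Suc m) t = ?TL m t - 2 * ?TL m (t + 1)" for m t
  proof (cases "even m")
    case True
    then obtain k where m: "m = 2 * k" by (elim evenE)
    show ?thesis by (simp add: m lucas[of t] algebra_simps)
  next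
    case False
    then show ?thesis by (simp add: lucas_int_eq_fib_int algebra_simps)
  qed
  show ?thesis
    using odd_binomial_sum[of fib_int ?TF n s, OF fib_int_rec _ stepF]
      odd_binomial_sum[of lucas_int ?TL n s, OF lucas_int_rec _ stepL]
    by simp
qed

end
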